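(* If $0<q<1/2$ then the measure $\mu_q$ is purely atomic, i.e. $\mu_q^*=0$. In other words, for every real $x>0$, $$[x]_q=\sum_{y\in\mathbb Q\cap(0,x]}\mathrm{Jump}_y(q),$$ and $[x]_q^*=\frac1{1-q}$ for all $x\in\mathbb R$.
   Context: $[n]_q=\frac{1-q^n}{1-q}$. For real $x\ge1$ write uniquely $x=[[c_1,c_2,\ldots]]:=c_1-\frac{1}{c_2-\frac{1}{c_3-\cdots}}$ with integers $c_j\ge2$; for $0<q<1$ the number $[x]_q$ is the limit as $N\to\infty$ of the real numbers $[c_1]_q-\frac{q^{c_1-1}}{[c_2]_q-\cdots\frac{q^{c_{N-1}-1}}{[c_N]_q}}$ (the limit exists). It is extended to all real $x$ by $[x+1]_q=q[x]_q+1$. For fixed $0<q<1$ the function $x\mapsto[x]_q$ is strictly increasing on $\mathbb R$, continuous at irrational points and right-continuous at rational points. For $y\in\mathbb Q$ put $\mathrm{Jump}_y(q):=[y]_q-\lim_{u\to y^-}[u]_q>0$. Let $\mu_q=d[x]_q$ be the Stieltjes measure on $\mathbb R$ with $\mu_q((x,y])=[y]_q-[x]_q$ for $x<y$; write $\mu_q=\mu_q^*+\sum_{y\in\mathbb Q}\mathrm{Jump}_y(q)\delta_y$ with $\mu_q^*$ atomless. Put $[x]_q^*:=[x]_q+\sum_{y\in\mathbb Q,\,y>x}\mathrm{Jump}_y(q)$, so that $\mu_q^*=d[x]_q^*$. *)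

theory Defs
  imports "HOL-Analysis.Analysis"
begin

definition qint :: "real \<Rightarrow> nat \<Rightarrow> real" where
  "qint q n = (1 - q ^ n) / (1 - q)"

text \<open>
  Digits c_1, c_2, ... are indexed from 0. The n-th convergent below uses the n + 1 digits
  c 0, ..., c n.
\<close>

fun nconv :: "nat \<Rightarrow> (nat \<Rightarrow> nat) \<Rightarrow> real" where
  "nconv 0 c = real (c 0)"
| "nconv (Suc n) c = real (c 0) - 1 / nconv n (\<lambda>j. c (Suc j))"

fun qconv :: "real \<Rightarrow> nat \<Rightarrow> (nat \<Rightarrow> nat) \<Rightarrow> real" where
  "qconv q 0 c = qint q (c 0)"
| "qconv q (Suc n) c = qint q (c 0) - q ^ (c 0 - 1) / qconv q n (\<lambda>j. c (Suc j))"

text \<open>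
  Expansions are always infinite, which makes them unique: the expansion of a rational number
  ends in 2, 2, 2, ...; in particular 1 = [[2, 2, 2, ...]].
\<close>

definition is_expansion :: "real \<Rightarrow> (nat \<Rightarrow> nat) \<Rightarrow> bool" where
  "is_expansion x c \<longleftrightarrow> (\<forall>j. c j \<ge> 2) \<and> (\<lambda>n. nconv n c) \<longlonglongrightarrow> x"

definition digits :: "real \<Rightarrow> nat \<Rightarrow> nat" where
  "digits x = (THE c. is_expansion x c)"

text \<open>For x < 1 the relation [x+1] = q [x] + 1 is solved for [x].\<close>

function qreal :: "real \<Rightarrow> real \<Rightarrow> real" where
  "qreal q x = (if x \<ge> 1 then lim (\<lambda>n. qconv q n (digits x)) else (qreal q (x + 1) - 1) / q)"
  by auto
termination
proof (relation "Wellfounded.measure (\<lambda>(q, x). nat \<lceil>1 - x\<rceil>)")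
  fix q x :: real
  assume "\<not> x \<ge> 1"
  then have "\<lceil>1 - x\<rceil> > 0" by simp
  moreover have "\<lceil>1 - (x + 1)\<rceil> = \<lceil>1 - x\<rceil> - 1"
    by (simp add: ceiling_diff_one[symmetric] algebra_simps del: ceiling_diff_one)
  ultimately show "((q, x + 1), (q, x)) \<in> Wellfounded.measure (\<lambda>(q, x). nat \<lceil>1 - x\<rceil>)"
    by simp
qed simp

declare qreal.simps [simp del]

definition jump :: "real \<Rightarrow> real \<Rightarrow> real" where
  "jump q y = qreal q y - Lim (at_left y) (qreal q)"

definition mu :: "real \<Rightarrow> real measure" where
  "mu q = interval_measure (qreal q)"

text \<open>
  The equation mu = nu + (sum over rational y of Jump_y times the Dirac measure at y), evaluated
  on Borel sets, with nu atomless. A sigma-finite Borel measure on the real line is atomless iff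
  all singletons are null sets.
\<close>

definition is_atomless_part :: "real \<Rightarrow> real measure \<Rightarrow> bool" where
  "is_atomless_part q \<nu> \<longleftrightarrow>
     sets \<nu> = sets borel \<and>
     (\<forall>x. emeasure \<nu> {x} = 0) \<and>
     (\<forall>A\<in>sets borel.
        emeasure (mu q) A =
        emeasure \<nu> A + (\<integral>\<^sup>+ y. ennreal (jump q y) * indicator A y \<partial>count_space \<rat>))"

definition mu_star :: "real \<Rightarrow> real measure" where
  "mu_star q = (THE \<nu>. is_atomless_part q \<nu>)"

definition qreal_star :: "real \<Rightarrow> real \<Rightarrow> real" where
  "qreal_star q x = qreal q x + (\<Sum>\<^sub>\<infinity>y\<in>{y \<in> \<rat>. y > x}. jump q y)"

end

theory Submission
  imports Defs
begin

text \<open>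
  Write \<open>f x = [x]\<^sub>q\<close>. On \<open>[0, \<infinity>)\<close> the continued fraction algorithm turns into the
  two equations \<open>f (x + 1) = q f x + 1\<close> and \<open>f (x / (x + 1)) = q f x / (1 + q f x)\<close>: each of
  the two generators of the Stern-Brocot tree acts on the values of \<open>f\<close> as a Moebius map. So
  for every composition \<open>m\<close> of such generators there are \<open>\<kappa>\<close> and \<open>\<rho>\<close> with
  \<open>f (m y) - f (m x) = \<kappa> (f y - f x) / ((1 + \<rho> f x) (1 + \<rho> f y))\<close>.
  Since \<open>f 0 = 0\<close> and \<open>f\<close> tends to \<open>1 / (1 - q)\<close> at infinity, the open Stern-Brocot interval
  \<open>m ` (0, \<infinity>)\<close> has mass \<open>\<kappa> / (1 - q + \<rho>)\<close>.

  Removing the rational point \<open>m 1\<close> splits this interval into \<open>m ` (0, 1)\<close> and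
  \<open>m ` (1, \<infinity>)\<close>. The parameter \<open>\<rho>\<close> starts at \<open>0\<close> and changes by \<open>\<rho> \<mapsto> q (1 + \<rho>)\<close> or
  \<open>\<rho> \<mapsto> q \<rho> / (1 + \<rho>)\<close>; it therefore never exceeds \<open>q / (1 - q)\<close>, and under this bound each
  of the two parts has at most \<open>q\<close> times the mass of the whole. After \<open>n\<close> subdivisions at most
  the fraction \<open>(2 q)\<^sup>n\<close> of the mass is left outside the rational points removed so far. For
  \<open>q < 1 / 2\<close> this tends to \<open>0\<close>, so the irrational numbers form a null set
  (\<open>emeasure_mu_irrational\<close>), and the measure of every Borel set is the sum of the masses of its
  rational points. The masses of these points are the jumps. The negative half-line is
  covered by starting from \<open>x \<mapsto> x - n\<close> in place of the identity: this map divides differences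
  of \<open>f\<close> by \<open>q\<^sup>n\<close>.

  To speak of the Stieltjes measure at all, \<open>f\<close> must be monotone and right-continuous.
  Monotonicity comes from comparing expansions at the first digit where they differ. The
  convergents of \<open>x\<close> decrease to \<open>x\<close>, and their \<open>f\<close>-values are the \<open>q\<close>-deformed convergents,
  which tend to \<open>f x\<close>; for monotone \<open>f\<close> this is right-continuity.
\<close>

section \<open>Negative continued fractions\<close>

text \<open>
  If \<open>x = [[c\<^sub>1, c\<^sub>2, \<dots>]]\<close> with all digits at least 2, then \<open>x = c\<^sub>1 - 1 / y\<close> with
  \<open>y = [[c\<^sub>2, \<dots>]] \<ge> 1\<close>, hence \<open>c\<^sub>1 - 1 \<le> x < c\<^sub>1\<close>. This determines \<open>c\<^sub>1 = \<lfloor>x\<rfloor> + 1\<close> and \<open>y\<close>,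
  so the digits are read off from the orbit of \<open>x\<close> under \<open>x \<mapsto> y\<close>.
\<close>

definition cf_tail :: "real \<Rightarrow> real" where
  "cf_tail x = 1 / (of_int \<lfloor>x\<rfloor> + 1 - x)"

definition cf_digits :: "real \<Rightarrow> nat \<Rightarrow> nat" where
  "cf_digits x j = nat (\<lfloor>(cf_tail ^^ j) x\<rfloor> + 1)"

lemma cf_tail_ge_1: "cf_tail x \<ge> 1"
proof -
  have "of_int \<lfloor>x\<rfloor> + 1 - x > 0" "of_int \<lfloor>x\<rfloor> + 1 - x \<le> 1" by linarith+
  thus ?thesis unfolding cf_tail_def by simp
qed

lemma cf_tail_eq: "x = of_int \<lfloor>x\<rfloor> + 1 - 1 / cf_tail x"
  by (simp add: cf_tail_def)

lemma cf_floor_tail_unique: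
  assumes "y \<ge> 1"
  shows "\<lfloor>of_int k - 1 / y\<rfloor> = k - 1" "cf_tail (of_int k - 1 / y) = y"
proof -
  have "0 < 1 / y" "1 / y \<le> 1" using assms by simp_all
  thus 1: "\<lfloor>of_int k - 1 / y\<rfloor> = k - 1" by linarith
  show "cf_tail (of_int k - 1 / y) = y" unfolding cf_tail_def 1 by simp
qed

lemma cf_digits_0: "cf_digits x 0 = nat (\<lfloor>x\<rfloor> + 1)"
  and cf_digits_Suc: "cf_digits x (Suc j) = cf_digits (cf_tail x) j"
  by (simp_all add: cf_digits_def funpow_swap1)

lemma cf_digits_ge_2:
  assumes "x \<ge> 1"
  shows "cf_digits x j \<ge> 2"
proof -
  have "(cf_tail ^^ j) x \<ge> 1" using assms cf_tail_ge_1 by (cases j) auto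
  hence "\<lfloor>(cf_tail ^^ j) x\<rfloor> \<ge> 1" by simp
  thus ?thesis unfolding cf_digits_def by linarith
qed

text \<open>
  Two distinct numbers have expansions that differ somewhere, and statements about a pair can be
  proved by induction on the position of the first difference. As long as the floors agree,
  \<open>cf_tail y - cf_tail x = (y - x) * cf_tail x * cf_tail y\<close>, where \<open>cf_tail x \<ge> 1\<close> and
  \<open>cf_tail y \<ge> 1 + (y - x)\<close>. So the distance \<open>d\<close> grows by at least \<open>d\<^sup>2\<close> in each step,
  whereas numbers with equal floors are less than 1 apart.
\<close>

lemma cf_separation_induct [consumes 2, case_names base step]:
  assumes "1 \<le> x" "x < y"
    and base: "\<And>x y. 1 \<le> x \<Longrightarrow> \<lfloor>x\<rfloor> < \<lfloor>y\<rfloor> \<Longrightarrow> P x y"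
    and step: "\<And>x y. 1 \<le> x \<Longrightarrow> x < y \<Longrightarrow> \<lfloor>x\<rfloor> = \<lfloor>y\<rfloor> \<Longrightarrow> P (cf_tail x) (cf_tail y) \<Longrightarrow> P x y"
  shows "P x y"
proof -
  define d where "d = y - x"
  have d: "d > 0" using assms d_def by simp
  \<comment> \<open>\<open>n\<close> bounds the number of steps after which the distance is at least 1\<close>
  have claim: "P u v" if "1 \<le> u" "d \<le> v - u" "real n * d\<^sup>2 + (v - u) \<ge> 1" for n u v
    using that
  proof (induction n arbitrary: u v)
    case 0
    then show ?case by (intro base) linarith+
  next
    case (Suc n)
    show ?case
    proof (cases "\<lfloor>u\<rfloor> = \<lfloor>v\<rfloor>")
      case False
      with Suc d show ?thesis by (intro base) (auto simp: less_le floor_mono)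
    next
      case True
      let ?a = "cf_tail u" and ?b = "cf_tail v"
      have a: "?a \<ge> 1" and b: "?b \<ge> 1" by (rule cf_tail_ge_1)+
      have "v - u = 1 / ?a - 1 / ?b" using cf_tail_eq[of u] cf_tail_eq[of v] True by simp
      hence e: "?b - ?a = (v - u) * ?a * ?b" using a b by (simp add: field_simps)
      have "(v - u) * 1 * 1 \<le> (v - u) * ?a * ?b"
        using a b d Suc.prems by (intro mult_mono) auto
      hence grow: "v - u \<le> ?b - ?a" using e by simp
      have "d\<^sup>2 \<le> (v - u) * (v - u)"
        unfolding power2_eq_square using d Suc.prems by (intro mult_mono) auto
      moreover have "(v - u) * 1 * (1 + (v - u)) \<le> (v - u) * ?a * ?b"
        using a b d Suc.prems grow by (intro mult_mono) auto
      ultimately have "(v - u) + d\<^sup>2 \<le> ?b - ?a" using e by (simp add: algebra_simps)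
      moreover have "real (Suc n) * d\<^sup>2 = real n * d\<^sup>2 + d\<^sup>2" by (simp add: algebra_simps)
      ultimately have "real n * d\<^sup>2 + (?b - ?a) \<ge> 1" using Suc.prems(3) by linarith
      hence "P ?a ?b" using Suc.prems(2) grow a by (intro Suc.IH) linarith+
      moreover have "u < v" using Suc.prems d by linarith
      ultimately show ?thesis using Suc.prems(1) True by (metis step)
    qed
  qed
  obtain n where "1 / d\<^sup>2 < real n" using reals_Archimedean2 by blast
  hence "real n * d\<^sup>2 \<ge> 1" using d by (simp add: field_simps)
  thus ?thesis using assms d by (intro claim[of x y n]) (auto simp: d_def)
qed

lemma cf_digits_inj:
  assumes "1 \<le> x" "1 \<le> y" "cf_digits x = cf_digits y"
  shows "x = y"
proof -
  have *: "cf_digits u \<noteq> cf_digits v" if "1 \<le> u" "u < v" for u v :: real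
    using that
  proof (induction rule: cf_separation_induct)
    case (base x y)
    hence "1 \<le> \<lfloor>x\<rfloor>" by simp
    hence "cf_digits x 0 \<noteq> cf_digits y 0" using base unfolding cf_digits_0 by linarith
    thus ?case by metis
  next
    case (step x y)
    thus ?case by (metis cf_digits_Suc ext)
  qed
  from *[of x y] *[of y x] assms show ?thesis by (metis linorder_neqE)
qed

text \<open>
  Ordinary and \<open>q\<close>-deformed convergents obey the same kind of recursion, and their convergence
  has the same reason. The condition \<open>a k - b k \<ge> 1\<close> keeps every denominator at least 1; then
  lengthening the fraction only subtracts more, so the convergents decrease.
\<close>

lemma nested_fraction_ge_1:
  fixes X :: "nat \<Rightarrow> (nat \<Rightarrow> nat) \<Rightarrow> real" and a b :: "nat \<Rightarrow> real"
  assumes X0: "\<And>c. X 0 c = a (c 0)"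
    and XS: "\<And>n c. X (Suc n) c = a (c 0) - b (c 0) / X n (\<lambda>j. c (Suc j))"
    and b: "\<And>k. k \<ge> 2 \<Longrightarrow> b k \<ge> 0" and ab: "\<And>k. k \<ge> 2 \<Longrightarrow> a k - b k \<ge> 1"
    and c: "\<And>j. c j \<ge> 2"
  shows "X n c \<ge> 1"
  using c
proof (induction n arbitrary: c)
  case 0
  show ?case using X0[of c] b[of "c 0"] ab[of "c 0"] 0 by simp
next
  case (Suc n)
  have "b (c 0) / X n (\<lambda>j. c (Suc j)) \<le> b (c 0) / 1"
    using Suc.IH[of "\<lambda>j. c (Suc j)"] Suc.prems b by (intro divide_left_mono) auto
  then show ?case using XS[of n c] ab[of "c 0"] Suc.prems[of 0] by simp
qed

lemma nested_fraction_limit: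
  fixes X :: "nat \<Rightarrow> (nat \<Rightarrow> nat) \<Rightarrow> real" and a b :: "nat \<Rightarrow> real"
  assumes X0: "\<And>c. X 0 c = a (c 0)"
    and XS: "\<And>n c. X (Suc n) c = a (c 0) - b (c 0) / X n (\<lambda>j. c (Suc j))"
    and b: "\<And>k. k \<ge> 2 \<Longrightarrow> b k \<ge> 0" and ab: "\<And>k. k \<ge> 2 \<Longrightarrow> a k - b k \<ge> 1"
    and c: "\<And>j. c j \<ge> 2"
  shows "(\<lambda>n. X n c) \<longlonglongrightarrow> lim (\<lambda>n. X n c)"
    and "lim (\<lambda>n. X n c) \<ge> 1"
    and "lim (\<lambda>n. X n c) = a (c 0) - b (c 0) / lim (\<lambda>n. X n (\<lambda>j. c (Suc j)))"
proof -
  note ge = nested_fraction_ge_1[of X a b, OF X0 XS b ab]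
  have dec: "X (Suc n) c \<le> X n c" if "\<And>j. c j \<ge> 2" for n c
    using that
  proof (induction n arbitrary: c)
    case 0
    have "b (c 0) / X 0 (\<lambda>j. c (Suc j)) \<ge> 0"
      using 0 b[of "c 0"] ge[of "\<lambda>j. c (Suc j)" 0] by simp
    then show ?case by (simp only: X0 XS)
  next
    case (Suc n)
    let ?t = "\<lambda>j. c (Suc j)"
    have "b (c 0) / X n ?t \<le> b (c 0) / X (Suc n) ?t"
      using Suc.IH[of ?t] Suc.prems b[of "c 0"] ge[of ?t n] ge[of ?t "Suc n"]
      by (intro divide_left_mono) auto
    then show ?case using XS[of n c] XS[of "Suc n" c] by linarith
  qed
  have conv: "(\<lambda>n. X n c) \<longlonglongrightarrow> lim (\<lambda>n. X n c)" if "\<And>j. c j \<ge> 2" for c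
  proof -
    have "decseq (\<lambda>n. X n c)" using dec[of c] that by (intro decseq_SucI) auto
    thus ?thesis using decseq_convergent[of "\<lambda>n. X n c" 1] ge[of c] that
      by (metis limI)
  qed
  have lim1: "lim (\<lambda>n. X n c) \<ge> 1" if "\<And>j. c j \<ge> 2" for c
    using conv[of c] ge[of c] that by (intro LIMSEQ_le_const[of _ _ 1]) auto
  let ?t = "\<lambda>j. c (Suc j)"
  show C: "(\<lambda>n. X n c) \<longlonglongrightarrow> lim (\<lambda>n. X n c)" using conv c .
  show "lim (\<lambda>n. X n c) \<ge> 1" using lim1 c .
  have "(\<lambda>n. X (Suc n) c) \<longlonglongrightarrow> a (c 0) - b (c 0) / lim (\<lambda>n. X n ?t)"
    unfolding XS using conv[of ?t] lim1[of ?t] c by (intro tendsto_intros) auto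
  from LIMSEQ_unique[OF LIMSEQ_Suc[OF C] this]
  show "lim (\<lambda>n. X n c) = a (c 0) - b (c 0) / lim (\<lambda>n. X n ?t)" .
qed

abbreviation cf_value :: "(nat \<Rightarrow> nat) \<Rightarrow> real" where
  "cf_value c \<equiv> lim (\<lambda>n. nconv n c)"

lemma nconv_ge_1:
  assumes "\<And>j. c j \<ge> 2"
  shows "nconv n c \<ge> 1"
  by (rule nested_fraction_ge_1[of nconv real "\<lambda>_. 1"]) (use assms in auto)

lemma cf_value_limit:
  assumes "\<And>j. c j \<ge> 2"
  shows "(\<lambda>n. nconv n c) \<longlonglongrightarrow> cf_value c" "cf_value c \<ge> 1"
    "cf_value c = real (c 0) - 1 / cf_value (\<lambda>j. c (Suc j))"
  by (rule nested_fraction_limit[of nconv real "\<lambda>_. 1"]; use assms in auto)+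

lemma cf_digits_cf_value:
  assumes "\<And>j. c j \<ge> 2"
  shows "cf_digits (cf_value c) = c"
proof
  fix j
  show "cf_digits (cf_value c) j = c j" using assms
  proof (induction j arbitrary: c)
    case (0 c)
    let ?t = "\<lambda>j. c (Suc j)"
    have "\<lfloor>cf_value c\<rfloor> = int (c 0) - 1"
      using cf_floor_tail_unique(1)[of "cf_value ?t" "int (c 0)"]
        cf_value_limit[of c] cf_value_limit[of ?t] 0 by simp
    thus ?case by (simp add: cf_digits_0)
  next
    case (Suc j c)
    let ?t = "\<lambda>j. c (Suc j)"
    have "cf_tail (cf_value c) = cf_value ?t"
      using cf_floor_tail_unique(2)[of "cf_value ?t" "int (c 0)"]
        cf_value_limit[of c] cf_value_limit[of ?t] Suc.prems by simp
    thus ?case using Suc.IH[of ?t] Suc.prems by (simp add: cf_digits_Suc)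
  qed
qed

text \<open>
  The digits of the value of the digit sequence of \<open>x\<close> are again those of \<open>x\<close>, and digits
  separate points. This replaces an estimate of \<open>\<bar>nconv n c - x\<bar>\<close>, whose recursion does not
  contract at 1.
\<close>

lemma cf_value_cf_digits:
  assumes "x \<ge> 1"
  shows "cf_value (cf_digits x) = x"
  using assms cf_digits_ge_2[OF assms] cf_value_limit(2)[of "cf_digits x"]
  by (intro cf_digits_inj cf_digits_cf_value) auto

lemma digits_eq_cf_digits:
  assumes "x \<ge> 1"
  shows "digits x = cf_digits x"
  unfolding digits_def
proof (rule the_equality)
  have ge: "\<And>j. cf_digits x j \<ge> 2" using assms by (rule cf_digits_ge_2)
  show "is_expansion x (cf_digits x)"
    unfolding is_expansion_def
    using ge cf_value_limit(1)[of "cf_digits x", OF ge] cf_value_cf_digits[OF assms] by simp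
next
  fix c assume "is_expansion x c"
  hence c: "\<And>j. c j \<ge> 2" and "(\<lambda>n. nconv n c) \<longlonglongrightarrow> x" by (auto simp: is_expansion_def)
  hence "cf_value c = x" by (intro limI)
  thus "c = cf_digits x" using cf_digits_cf_value[of c, OF c] by simp
qed

section \<open>Functional equations of the \<open>q\<close>-deformation\<close>

context
  fixes q :: real
  assumes q: "0 < q" "q < 1"
begin

lemma qint_Suc: "qint q (Suc n) = 1 + q * qint q n"
  using q by (simp add: qint_def field_simps)

lemma qint_Suc': "qint q (Suc n) = qint q n + q ^ n"
  using q by (simp add: qint_def field_simps)

lemma qint_0: "qint q 0 = 0" and qint_1: "qint q (Suc 0) = 1"
  using q by (simp_all add: qint_def)

lemma qint_mono: "m \<le> n \<Longrightarrow> qint q m \<le> qint q n"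
  by (rule lift_Suc_mono_le[of "qint q"]) (use q in \<open>auto simp: qint_Suc'\<close>)

lemma qint_minus_power:
  assumes "k \<ge> 1"
  shows "qint q k - q ^ (k - 1) = qint q (k - 1)"
  using qint_Suc'[of "k - 1"] assms by simp

lemma qconv_limit:
  assumes "\<And>j. c j \<ge> 2"
  shows "(\<lambda>n. qconv q n c) \<longlonglongrightarrow> lim (\<lambda>n. qconv q n c)" "lim (\<lambda>n. qconv q n c) \<ge> 1"
    "lim (\<lambda>n. qconv q n c) = qint q (c 0) - q ^ (c 0 - 1) / lim (\<lambda>n. qconv q n (\<lambda>j. c (Suc j)))"
proof -
  have "qint q k - q ^ (k - 1) \<ge> 1" if "k \<ge> 2" for k
    using qint_minus_power[of k] qint_mono[of 1 "k - 1"] qint_1 that by simp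
  note * = nested_fraction_limit[of "qconv q" "qint q" "\<lambda>k. q ^ (k - 1)", OF _ _ _ this assms]
  show "(\<lambda>n. qconv q n c) \<longlonglongrightarrow> lim (\<lambda>n. qconv q n c)" "lim (\<lambda>n. qconv q n c) \<ge> 1"
    "lim (\<lambda>n. qconv q n c) = qint q (c 0) - q ^ (c 0 - 1) / lim (\<lambda>n. qconv q n (\<lambda>j. c (Suc j)))"
    by (rule *; use q in simp)+
qed

lemma qreal_eq_lim:
  assumes "x \<ge> 1"
  shows "qreal q x = lim (\<lambda>n. qconv q n (cf_digits x))"
  using assms by (subst qreal.simps) (simp add: digits_eq_cf_digits)

lemma qreal_ge_1:
  assumes "x \<ge> 1"
  shows "qreal q x \<ge> 1"
  using qconv_limit(2)[of "cf_digits x"] cf_digits_ge_2[OF assms] qreal_eq_lim[OF assms] by simp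

text \<open>
  Prepending a digit to an expansion; all other functional equations are consequences of this
  one and of the extension to \<open>x < 1\<close>.
\<close>

lemma qreal_minus_inverse:
  assumes "k \<ge> 2" "y \<ge> 1"
  shows "qreal q (real k - 1 / y) = qint q k - q ^ (k - 1) / qreal q y"
proof -
  let ?x = "real k - 1 / y"
  note u = cf_floor_tail_unique[OF assms(2), of "int k", simplified]
  have x: "?x \<ge> 1"
  proof -
    have "1 / y \<le> 1" using assms by simp
    thus ?thesis using assms(1) by linarith
  qed
  have d0: "cf_digits ?x 0 = k" using u by (simp add: cf_digits_0)
  have t: "(\<lambda>j. cf_digits ?x (Suc j)) = cf_digits y" using u by (simp add: cf_digits_Suc)
  show ?thesis
    using qconv_limit(3)[of "cf_digits ?x"] cf_digits_ge_2[OF x]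
    unfolding d0 t qreal_eq_lim[OF x] qreal_eq_lim[OF assms(2)] by simp
qed

lemma qreal_expand:
  assumes "x \<ge> 1"
  shows "qreal q x = qint q (nat \<lfloor>x\<rfloor> + 1) - q ^ nat \<lfloor>x\<rfloor> / qreal q (cf_tail x)"
proof -
  have f: "\<lfloor>x\<rfloor> \<ge> 1" using assms by simp
  have "real (nat \<lfloor>x\<rfloor> + 1) - 1 / cf_tail x = x" using cf_tail_eq[of x] f by simp
  moreover have "nat \<lfloor>x\<rfloor> + 1 \<ge> 2" using f by linarith
  ultimately show ?thesis
    using qreal_minus_inverse[of "nat \<lfloor>x\<rfloor> + 1" "cf_tail x"] cf_tail_ge_1[of x] by simp
qed

lemma qreal_plus_1: "qreal q (x + 1) = q * qreal q x + 1"
proof (cases "x \<ge> 1")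
  case False
  thus ?thesis using q by (simp add: qreal.simps[of q x])
next
  case True
  have "\<lfloor>x\<rfloor> \<ge> 1" using True by simp
  hence n: "nat \<lfloor>x + 1\<rfloor> = Suc (nat \<lfloor>x\<rfloor>)" by (simp add: nat_add_distrib)
  have t: "cf_tail (x + 1) = cf_tail x" by (simp add: cf_tail_def)
  have "qreal q (x + 1) =
      qint q (Suc (Suc (nat \<lfloor>x\<rfloor>))) - q * q ^ nat \<lfloor>x\<rfloor> / qreal q (cf_tail x)"
    using qreal_expand[of "x + 1"] True unfolding n t by simp
  also have "\<dots> = q * (qint q (nat \<lfloor>x\<rfloor> + 1) - q ^ nat \<lfloor>x\<rfloor> / qreal q (cf_tail x)) + 1"
    by (simp add: qint_Suc algebra_simps)
  finally show ?thesis using qreal_expand[OF True] by simp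
qed

text \<open>
  The expansion of 1 is periodic, so the value solves \<open>t\<^sup>2 - (1 + q) t + q = 0\<close>. Of the roots 1
  and \<open>q\<close>, only 1 is compatible with \<open>t \<ge> 1\<close>.
\<close>

lemma qreal_1: "qreal q 1 = 1"
proof -
  let ?t = "qreal q 1"
  have t: "?t \<ge> 1" by (simp add: qreal_ge_1)
  have "?t = 1 + q - q / ?t" using qreal_minus_inverse[of 2 1]
    by (simp add: numeral_2_eq_2 qint_Suc qint_0)
  hence "(?t - 1) * (?t - q) = 0" using t by (simp add: field_simps)
  thus ?thesis using t q by auto
qed

lemma qreal_0: "qreal q 0 = 0"
  using qreal_plus_1[of 0] qreal_1 q by simp

lemma qreal_of_nat: "qreal q (real n) = qint q n"
proof (induction n)
  case (Suc n)
  show ?case using qreal_plus_1[of "real n"] Suc by (simp add: qint_Suc add.commute)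
qed (simp add: qreal_0 qint_0)

lemma qreal_minus_of_nat: "qreal q (x - real n) = (qreal q x - qint q n) / q ^ n"
proof (induction n)
  case (Suc n)
  have "qreal q (x - real n) = q * qreal q (x - real (Suc n)) + 1"
    using qreal_plus_1[of "x - real (Suc n)"] by simp
  hence "qreal q (x - real (Suc n)) = ((qreal q x - qint q n) / q ^ n - 1) / q"
    using Suc q by (simp add: field_simps)
  thus ?case using q by (simp add: qint_Suc' field_simps)
qed (simp add: qint_0)

lemma qreal_nonneg:
  assumes "x \<ge> 0"
  shows "qreal q x \<ge> 0"
  using qreal_plus_1[of x] qreal_ge_1[of "x + 1"] assms q by (simp add: zero_le_mult_iff)

text \<open>
  Since \<open>x / (x + 1) + 1 = 2 - 1 / (x + 1)\<close>, the left Stern-Brocot generator is a shift followed by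
  prepending the digit 2 and shifting back.
\<close>

lemma qreal_x_over_x_plus_1:
  assumes "x \<ge> 0"
  shows "qreal q (x / (x + 1)) = q * qreal q x / (1 + q * qreal q x)"
proof -
  let ?F = "qreal q x"
  have e: "x / (x + 1) + 1 = real 2 - 1 / (x + 1)" using assms by (simp add: field_simps)
  have p: "1 + q * ?F > 0" using q qreal_nonneg[OF assms] by (simp add: add_pos_nonneg)
  have "q * qreal q (x / (x + 1)) + 1 = 1 + q - q / (q * ?F + 1)"
    using qreal_minus_inverse[of 2 "x + 1"] assms
    unfolding qreal_plus_1[symmetric] e by (simp add: numeral_2_eq_2 qint_Suc qint_0)
  hence "q * qreal q (x / (x + 1)) = q * (1 - 1 / (q * ?F + 1))" by (simp add: algebra_simps)
  hence "qreal q (x / (x + 1)) = 1 - 1 / (q * ?F + 1)" using q by simp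
  thus ?thesis using p by (simp add: field_simps)
qed

text \<open>
  At the first differing digit the values are separated by \<open>[c]\<^sub>q\<close> with \<open>c = \<lfloor>x\<rfloor> + 1 \<le> \<lfloor>y\<rfloor>\<close>, because
  the deformed tails are at least 1; earlier digits are prepended by an increasing map.
\<close>

lemma qreal_strict_mono_ge_1:
  assumes "1 \<le> x" "x < y"
  shows "qreal q x < qreal q y"
  using assms
proof (induction rule: cf_separation_induct)
  case (base x y)
  have fx: "\<lfloor>x\<rfloor> \<ge> 1" using base by simp
  hence y: "y \<ge> 1" using base by linarith
  have "qreal q x < qint q (nat \<lfloor>x\<rfloor> + 1)"
    using qreal_expand[of x] base qreal_ge_1[OF cf_tail_ge_1[of x]] q by simp
  also have "\<dots> \<le> qint q (nat \<lfloor>y\<rfloor>)" using base fx by (intro qint_mono) linarith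
  also have "\<dots> = qint q (nat \<lfloor>y\<rfloor> + 1) - q ^ nat \<lfloor>y\<rfloor> / 1" by (simp add: qint_Suc')
  also have "\<dots> \<le> qint q (nat \<lfloor>y\<rfloor> + 1) - q ^ nat \<lfloor>y\<rfloor> / qreal q (cf_tail y)"
    using qreal_ge_1[OF cf_tail_ge_1[of y]] q by (intro diff_mono divide_left_mono) auto
  also have "\<dots> = qreal q y" using qreal_expand[of y] y by simp
  finally show ?case .
next
  case (step x y)
  have "q ^ nat \<lfloor>y\<rfloor> / qreal q (cf_tail y) < q ^ nat \<lfloor>y\<rfloor> / qreal q (cf_tail x)"
    using qreal_ge_1[OF cf_tail_ge_1[of x]] qreal_ge_1[OF cf_tail_ge_1[of y]] step q
    by (intro divide_strict_left_mono) auto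
  thus ?case using qreal_expand[of x] qreal_expand[of y] step by simp
qed

lemma qreal_mono:
  assumes "x \<le> y"
  shows "qreal q x \<le> qreal q y"
proof (cases "x = y")
  case False
  obtain n where n: "real n \<ge> 1 - x" using real_arch_simple by blast
  have "qreal q (x + real n) < qreal q (y + real n)"
    using n assms False by (intro qreal_strict_mono_ge_1) auto
  thus ?thesis
    using qreal_minus_of_nat[of "x + real n" n] qreal_minus_of_nat[of "y + real n" n] q
    by (simp add: divide_right_mono)
qed simp

text \<open>
  A convergent is a finite expansion ending in an integer digit, and the functional equations
  evaluate the deformation on it.
\<close>

lemma qreal_nconv:
  assumes "\<And>j. c j \<ge> 2"
  shows "qreal q (nconv n c) = qconv q n c"
  using assms
proof (induction n arbitrary: c)
  case (Suc n)
  thus ?case using qreal_minus_inverse[of "c 0" "nconv n (\<lambda>j. c (Suc j))"]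
      nconv_ge_1[of "\<lambda>j. c (Suc j)" n] by simp
qed (simp add: qreal_of_nat)

lemma nconv_greater:
  assumes "x \<ge> 1"
  shows "x < nconv n (cf_digits x)"
  using assms
proof (induction n arbitrary: x)
  case 0
  hence "\<lfloor>x\<rfloor> \<ge> 1" by simp
  thus ?case unfolding nconv.simps cf_digits_0 by linarith
next
  case (Suc n)
  have "cf_tail x < nconv n (cf_digits (cf_tail x))" by (intro Suc.IH cf_tail_ge_1)
  hence "1 / nconv n (cf_digits (cf_tail x)) < 1 / cf_tail x"
    using cf_tail_ge_1[of x] by (intro divide_strict_left_mono) auto
  moreover have "x = real (cf_digits x 0) - 1 / cf_tail x"
    using cf_tail_eq[of x] Suc.prems by (simp add: cf_digits_0)
  moreover have "nconv (Suc n) (cf_digits x) = real (cf_digits x 0) - 1 / nconv n (cf_digits (cf_tail x))"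
    by (simp add: cf_digits_Suc)
  ultimately show ?case by linarith
qed

text \<open>
  The convergents lie to the right of \<open>x\<close> and have values tending to \<open>[x]\<^sub>q\<close>. By monotonicity
  one such point already controls the values between it and \<open>x\<close>.
\<close>

lemma qreal_right_limit_ge_1:
  assumes "x \<ge> 1" "e > 0"
  shows "\<exists>y>x. qreal q y < qreal q x + e"
proof -
  have ge: "\<And>j. cf_digits x j \<ge> 2" using assms by (intro cf_digits_ge_2)
  have "(\<lambda>n. qconv q n (cf_digits x)) \<longlonglongrightarrow> qreal q x"
    using qconv_limit(1)[of "cf_digits x", OF ge] qreal_eq_lim[OF assms(1)] by simp
  hence "\<forall>\<^sub>F n in sequentially. qconv q n (cf_digits x) < qreal q x + e"
    using assms by (intro order_tendstoD) auto
  then obtain n where "qconv q n (cf_digits x) < qreal q x + e"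
    by (auto simp: eventually_sequentially)
  thus ?thesis using nconv_greater[OF assms(1), of n] qreal_nconv[of "cf_digits x" n, OF ge] by metis
qed

lemma qreal_right_continuous: "continuous (at_right x) (qreal q)"
proof (rule continuous_within[THEN iffD2], rule order_tendstoI)
  fix a assume "a < qreal q x"
  moreover have "qreal q x \<le> qreal q y" if "y > x" for y using that by (intro qreal_mono) auto
  ultimately show "\<forall>\<^sub>F y in at_right x. a < qreal q y"
    by (auto simp: eventually_at_filter intro!: always_eventually dest: less_le_trans)
next
  fix a assume a: "qreal q x < a"
  obtain n where n: "real n \<ge> 1 - x" using real_arch_simple by blast
  define e where "e = (a - qreal q x) * q ^ n"
  have "e > 0" using a q by (simp add: e_def)
  then obtain y where y: "y > x + real n" "qreal q y < qreal q (x + real n) + e"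
    using qreal_right_limit_ge_1[of "x + real n" e] n by auto
  have "qreal q (y - real n) < (qreal q (x + real n) + e - qint q n) / q ^ n"
    unfolding qreal_minus_of_nat using y q by (intro divide_strict_right_mono) auto
  also have "\<dots> = qreal q x + e / q ^ n"
    using qreal_minus_of_nat[of "x + real n" n] by (simp add: add_divide_distrib diff_divide_distrib)
  also have "\<dots> = a" using q by (simp add: e_def)
  finally have less: "qreal q (y - real n) < a" .
  have "\<forall>\<^sub>F z in at_right x. z < y - real n" using y
    by (intro eventually_at_rightI[of x "y - real n"]) auto
  thus "\<forall>\<^sub>F z in at_right x. qreal q z < a"
    by eventually_elim (rule le_less_trans[OF qreal_mono less], simp)
qed

lemma qint_tendsto: "qint q \<longlonglongrightarrow> 1 / (1 - q)"
proof -
  have "(\<lambda>n. (1 - q ^ n) / (1 - q)) \<longlonglongrightarrow> (1 - 0) / (1 - q)"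
    using q by (intro tendsto_intros LIMSEQ_power_zero) auto
  thus ?thesis by (simp add: qint_def[abs_def])
qed

section \<open>The Stieltjes measure\<close>

lemma rat_borel: "(\<rat> :: real set) \<in> sets borel"
  by (rule sets.countable) (auto simp: countable_rat)

lemma sets_mu: "sets (mu q) = sets borel"
  by (simp add: mu_def)

lemma emeasure_mu_Ioc:
  assumes "a \<le> b"
  shows "emeasure (mu q) {a<..b} = ennreal (qreal q b - qreal q a)"
  unfolding mu_def using assms qreal_mono qreal_right_continuous
  by (intro emeasure_interval_measure_Ioc) auto

lemma qreal_tendsto_left: "(qreal q \<longlongrightarrow> (SUP u\<in>{..<y}. qreal q u)) (at_left y)"
proof (rule increasing_tendsto)
  have bdd: "bdd_above (qreal q ` {..<y})"
    by (rule bdd_aboveI[of _ "qreal q y"]) (auto intro: qreal_mono)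
  show "\<forall>\<^sub>F u in at_left y. qreal q u \<le> (SUP u\<in>{..<y}. qreal q u)"
    using bdd by (auto simp: eventually_at_filter intro!: always_eventually cSUP_upper)
  fix z assume "z < (SUP u\<in>{..<y}. qreal q u)"
  then obtain u where u: "u < y" "z < qreal q u"
    using less_cSUP_iff[OF _ bdd, of z] by (auto simp: lessThan_iff)
  have "\<forall>\<^sub>F v in at_left y. u < v" using u by (intro eventually_at_leftI[of u y]) auto
  thus "\<forall>\<^sub>F v in at_left y. z < qreal q v"
    by eventually_elim (rule less_le_trans[OF u(2) qreal_mono], simp)
qed

lemma emeasure_mu_singleton: "emeasure (mu q) {y} = ennreal (jump q y)"
  and jump_nonneg: "jump q y \<ge> 0"
proof -
  define l where "l = (SUP u\<in>{..<y}. qreal q u)"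
  have l: "(qreal q \<longlongrightarrow> l) (at_left y)" unfolding l_def by (rule qreal_tendsto_left)
  hence j: "jump q y = qreal q y - l" unfolding jump_def
    by (simp add: tendsto_Lim trivial_limit_at_left_real)
  have "l \<le> qreal q y"
    by (rule tendsto_upperbound[OF l])
       (auto simp: eventually_at_filter intro!: always_eventually qreal_mono)
  thus "jump q y \<ge> 0" using j by simp
  let ?u = "\<lambda>n. y - inverse (real (Suc n))"
  have u: "filterlim ?u (at_left y) sequentially"
  proof (rule tendsto_imp_filterlim_at_left)
    have "?u \<longlonglongrightarrow> y - 0" by (intro tendsto_intros LIMSEQ_inverse_real_of_nat)
    thus "?u \<longlonglongrightarrow> y" by simp
  qed auto
  have "(\<lambda>n. qreal q y - qreal q (?u n)) \<longlonglongrightarrow> jump q y"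
    unfolding j by (intro tendsto_intros filterlim_compose[OF l u])
  hence A: "(\<lambda>n. emeasure (mu q) {?u n<..y}) \<longlonglongrightarrow> ennreal (jump q y)"
    by (subst emeasure_mu_Ioc) (auto intro!: tendsto_ennrealI)
  have "(\<lambda>n. emeasure (mu q) {?u n<..y}) \<longlonglongrightarrow> emeasure (mu q) (\<Inter>n. {?u n<..y})"
  proof (rule Lim_emeasure_decseq)
    show "decseq (\<lambda>n. {?u n<..y})"
      by (rule decseq_SucI) (auto simp: field_simps intro: le_less_trans[rotated])
    show "\<And>n. emeasure (mu q) {?u n<..y} \<noteq> \<infinity>" by (subst emeasure_mu_Ioc) auto
  qed (auto simp: sets_mu)
  moreover have "(\<Inter>n. {?u n<..y}) = {y}"
  proof (intro set_eqI iffI)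
    fix z assume z: "z \<in> (\<Inter>n. {?u n<..y})"
    have "?u \<longlonglongrightarrow> y - 0" by (intro tendsto_intros LIMSEQ_inverse_real_of_nat)
    hence "y - 0 \<le> z" by (rule LIMSEQ_le_const2) (use z in \<open>auto intro!: less_imp_le\<close>)
    thus "z \<in> {y}" using z by auto
  qed auto
  ultimately show "emeasure (mu q) {y} = ennreal (jump q y)"
    using A LIMSEQ_unique by metis
qed

section \<open>Stern-Brocot intervals\<close>

text \<open>
  The predicate describes the inverse branches of the Stern-Brocot subdivision: \<open>m\<close>
  parametrizes an interval by \<open>[0, \<infinity>)\<close>, so that children are obtained by precomposing with
  the two generators. The last clause says how \<open>m\<close> acts on the values \<open>t = [x]\<^sub>q\<close>:
  it is the difference formula of a Moebius map with denominator proportional to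
  \<open>1 + \<rho> t\<close> and with derivative \<open>\<kappa>\<close> at \<open>t = 0\<close>. Only
  differences enter into masses, so \<open>\<kappa>\<close> and \<open>\<rho>\<close> carry all that matters of the map. The bound
  \<open>q / (1 - q)\<close> is the fixed point of \<open>\<rho> \<mapsto> q (1 + \<rho>)\<close>.
\<close>

definition sb_branch :: "(real \<Rightarrow> real) \<Rightarrow> real \<Rightarrow> real \<Rightarrow> bool" where
  "sb_branch m \<kappa> \<rho> \<longleftrightarrow>
     continuous_on {0..} m \<and> strict_mono_on {0..} m \<and> m ` (\<rat> \<inter> {0..}) \<subseteq> \<rat> \<and>
     0 < \<kappa> \<and> 0 \<le> \<rho> \<and> \<rho> \<le> q / (1 - q) \<and>
     (\<forall>x\<ge>0. \<forall>y\<ge>0. qreal q (m y) - qreal q (m x) =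
        \<kappa> * (qreal q y - qreal q x) / ((1 + \<rho> * qreal q x) * (1 + \<rho> * qreal q y)))"

text \<open>
  Translations serve as roots of the tree, one for each interval \<open>(-n, \<infinity>)\<close>; together these
  cover the real line.
\<close>

lemma sb_branch_shift: "sb_branch (\<lambda>x. x - real n) (1 / q ^ n) 0"
  unfolding sb_branch_def using q
  by (auto simp: qreal_minus_of_nat diff_divide_distrib intro!: continuous_intros strict_mono_onI)

lemma sb_branch_right:
  assumes "sb_branch m \<kappa> \<rho>"
  shows "sb_branch (\<lambda>x. m (x + 1)) (\<kappa> * q / (1 + \<rho>)\<^sup>2) (q * \<rho> / (1 + \<rho>))"
  unfolding sb_branch_def
proof (intro conjI allI impI)
  note m = assms[unfolded sb_branch_def]
  have r: "\<rho> \<ge> 0" using m by simp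
  show "continuous_on {0..} (\<lambda>x. m (x + 1))"
    by (rule continuous_on_compose2[of "{0..}" m]) (use m in \<open>auto intro!: continuous_intros\<close>)
  show "strict_mono_on {0..} (\<lambda>x. m (x + 1))"
    by (rule strict_mono_onI) (use m in \<open>auto simp: strict_mono_on_def\<close>)
  show "(\<lambda>x. m (x + 1)) ` (\<rat> \<inter> {0..}) \<subseteq> \<rat>"
    using m by (auto intro!: subsetD[of "m ` (\<rat> \<inter> {0..})" \<rat>])
  show "0 < \<kappa> * q / (1 + \<rho>)\<^sup>2" "0 \<le> q * \<rho> / (1 + \<rho>)" using m q by auto
  have "q * \<rho> / (1 + \<rho>) \<le> q * 1"
    using r q by (simp add: field_simps)
  also have "\<dots> \<le> q / (1 - q)" using q by (simp add: field_simps)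
  finally show "q * \<rho> / (1 + \<rho>) \<le> q / (1 - q)" .
  fix x y :: real assume xy: "0 \<le> x" "0 \<le> y"
  let ?a = "qreal q x" and ?b = "qreal q y"
  have ab: "?a \<ge> 0" "?b \<ge> 0" using xy by (simp_all add: qreal_nonneg)
  have *: "1 + \<rho> * (q * t + 1) = (1 + \<rho>) * (1 + q * \<rho> / (1 + \<rho>) * t)" for t
    using r by (simp add: field_simps)
  have "qreal q (m (y + 1)) - qreal q (m (x + 1)) =
      \<kappa> * (qreal q (y + 1) - qreal q (x + 1)) /
      ((1 + \<rho> * qreal q (x + 1)) * (1 + \<rho> * qreal q (y + 1)))"
    using m xy by auto
  also have "\<dots> = \<kappa> * (q * (?b - ?a)) /
      (((1 + \<rho>) * (1 + q * \<rho> / (1 + \<rho>) * ?a)) * ((1 + \<rho>) * (1 + q * \<rho> / (1 + \<rho>) * ?b)))"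
    unfolding qreal_plus_1 * by (simp add: algebra_simps)
  also have "\<dots> = \<kappa> * q / (1 + \<rho>)\<^sup>2 * (?b - ?a) /
      ((1 + q * \<rho> / (1 + \<rho>) * ?a) * (1 + q * \<rho> / (1 + \<rho>) * ?b))"
    by (simp add: power2_eq_square mult_ac)
  finally show "qreal q (m (y + 1)) - qreal q (m (x + 1)) = \<dots>" .
qed

lemma sb_branch_left:
  assumes "sb_branch m \<kappa> \<rho>"
  shows "sb_branch (\<lambda>x. m (x / (x + 1))) (\<kappa> * q) (q * (1 + \<rho>))"
  unfolding sb_branch_def
proof (intro conjI allI impI)
  note m = assms[unfolded sb_branch_def]
  have r: "\<rho> \<ge> 0" using m by simp
  show "continuous_on {0..} (\<lambda>x. m (x / (x + 1)))"
    by (rule continuous_on_compose2[of "{0..}" m]) (use m in \<open>auto intro!: continuous_intros\<close>)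
  show "strict_mono_on {0..} (\<lambda>x. m (x / (x + 1)))"
  proof (rule strict_mono_onI)
    fix x y :: real assume "x \<in> {0..}" "y \<in> {0..}" "x < y"
    moreover from this have "x / (x + 1) < y / (y + 1)" by (simp add: field_simps)
    ultimately show "m (x / (x + 1)) < m (y / (y + 1))" using m by (auto simp: strict_mono_on_def)
  qed
  show "(\<lambda>x. m (x / (x + 1))) ` (\<rat> \<inter> {0..}) \<subseteq> \<rat>"
    using m by (auto intro!: subsetD[of "m ` (\<rat> \<inter> {0..})" \<rat>])
  show "0 < \<kappa> * q" "0 \<le> q * (1 + \<rho>)" using m q by auto
  have "q * (1 + \<rho>) \<le> q * (1 + q / (1 - q))" using m q by (intro mult_left_mono) auto
  also have "\<dots> = q / (1 - q)" using q by (simp add: field_simps)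
  finally show "q * (1 + \<rho>) \<le> q / (1 - q)" .
  fix x y :: real assume xy: "0 \<le> x" "0 \<le> y"
  let ?a = "qreal q x" and ?b = "qreal q y"
  have ab: "?a \<ge> 0" "?b \<ge> 0" using xy by (simp_all add: qreal_nonneg)
  have pos: "1 + q * ?a > 0" "1 + q * ?b > 0" using ab q by (simp_all add: add_pos_nonneg)
  have *: "1 + \<rho> * (q * t / (1 + q * t)) = (1 + q * (1 + \<rho>) * t) / (1 + q * t)" if "1 + q * t > 0" for t
    using that by (simp add: field_simps)
  have d: "q * ?b / (1 + q * ?b) - q * ?a / (1 + q * ?a) = q * (?b - ?a) / ((1 + q * ?a) * (1 + q * ?b))"
    using pos by (simp add: field_simps)
  have "qreal q (m (y / (y + 1))) - qreal q (m (x / (x + 1))) =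
      \<kappa> * (qreal q (y / (y + 1)) - qreal q (x / (x + 1))) /
      ((1 + \<rho> * qreal q (x / (x + 1))) * (1 + \<rho> * qreal q (y / (y + 1))))"
    using m xy by auto
  also have "\<dots> = \<kappa> * (q * (?b - ?a) / ((1 + q * ?a) * (1 + q * ?b))) /
      (((1 + q * (1 + \<rho>) * ?a) / (1 + q * ?a)) * ((1 + q * (1 + \<rho>) * ?b) / (1 + q * ?b)))"
    unfolding qreal_x_over_x_plus_1[OF xy(1)] qreal_x_over_x_plus_1[OF xy(2)]
      *[OF pos(1)] *[OF pos(2)] d ..
  also have "\<dots> = \<kappa> * q * (?b - ?a) / ((1 + q * (1 + \<rho>) * ?a) * (1 + q * (1 + \<rho>) * ?b))"
    using pos by simp
  finally show "qreal q (m (y / (y + 1))) - qreal q (m (x / (x + 1))) = \<dots>" .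
qed

text \<open>
  The open interval is the increasing union of the half-open intervals from \<open>m 0\<close> to \<open>m n\<close>, whose
  masses are given by the difference formula at \<open>[0]\<^sub>q = 0\<close> and \<open>[n]\<^sub>q \<longlonglongrightarrow> 1 / (1 - q)\<close>.
\<close>

lemma sb_branch_measure:
  assumes "sb_branch m \<kappa> \<rho>"
  shows "m ` {0<..} \<in> sets borel" "emeasure (mu q) (m ` {0<..}) = ennreal (\<kappa> / (1 - q + \<rho>))"
proof -
  note m = assms[unfolded sb_branch_def]
  have sm: "m x < m y \<longleftrightarrow> x < y" "m x \<le> m y \<longleftrightarrow> x \<le> y" if "x \<ge> 0" "y \<ge> 0" for x y
    using m that strict_mono_on_less[of "{0..}" m x y] strict_mono_on_less_eq[of "{0..}" m x y] by auto
  have U: "m ` {0<..} = (\<Union>n. {m 0<..m (real n)})"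
  proof (intro set_eqI iffI)
    fix y assume "y \<in> m ` {0<..}"
    then obtain x where x: "x > 0" "y = m x" by auto
    obtain n where "x \<le> real n" using real_arch_simple by blast
    thus "y \<in> (\<Union>n. {m 0<..m (real n)})" using x sm by (auto intro!: exI[of _ n])
  next
    fix y assume "y \<in> (\<Union>n. {m 0<..m (real n)})"
    then obtain n where n: "m 0 < y" "y \<le> m (real n)" by auto
    have "continuous_on {0..real n} m" using m by (auto intro: continuous_on_subset)
    then obtain x where x: "0 \<le> x" "m x = y" using IVT'[of m 0 y "real n"] n by auto
    thus "y \<in> m ` {0<..}" using n by (cases "x = 0") auto
  qed
  show "m ` {0<..} \<in> sets borel" unfolding U by measurable
  have A: "(\<lambda>n. emeasure (mu q) {m 0<..m (real n)}) \<longlonglongrightarrow> emeasure (mu q) (m ` {0<..})"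
    unfolding U
  proof (rule Lim_emeasure_incseq)
    have "m (real n) \<le> m (real (Suc n))" for n using sm by simp
    thus "incseq (\<lambda>n. {m 0<..m (real n)})" 
      by (intro incseq_SucI subsetI) (metis greaterThanAtMost_iff order_trans)
  qed (auto simp: sets_mu)
  have r: "1 - q + \<rho> > 0" using m q by simp
  have "(\<lambda>n. \<kappa> * qint q n / (1 + \<rho> * qint q n)) \<longlonglongrightarrow>
      \<kappa> * (1 / (1 - q)) / (1 + \<rho> * (1 / (1 - q)))"
    using m q r by (intro tendsto_intros qint_tendsto) (auto simp: field_simps)
  also have "\<kappa> * (1 / (1 - q)) / (1 + \<rho> * (1 / (1 - q))) = \<kappa> / (1 - q + \<rho>)"
  proof -
    have "1 + \<rho> * (1 / (1 - q)) = (1 - q + \<rho>) / (1 - q)" using q by (simp add: field_simps)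
    thus ?thesis using q by simp
  qed
  finally have "(\<lambda>n. ennreal (\<kappa> * qint q n / (1 + \<rho> * qint q n))) \<longlonglongrightarrow> ennreal (\<kappa> / (1 - q + \<rho>))"
    by (rule tendsto_ennrealI)
  moreover have "emeasure (mu q) {m 0<..m (real n)} = ennreal (\<kappa> * qint q n / (1 + \<rho> * qint q n))" for n
  proof -
    have "qreal q (m (real n)) - qreal q (m 0) = \<kappa> * qint q n / (1 + \<rho> * qint q n)"
      using m by (simp add: qreal_0 qreal_of_nat)
    thus ?thesis using sm by (simp add: emeasure_mu_Ioc)
  qed
  ultimately show "emeasure (mu q) (m ` {0<..}) = ennreal (\<kappa> / (1 - q + \<rho>))"
    using LIMSEQ_unique[OF A] by simp
qed

lemma sb_branch_split:
  assumes "sb_branch m \<kappa> \<rho>"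
  shows "m ` {0<..} - \<rat> = ((\<lambda>x. m (x + 1)) ` {0<..} - \<rat>) \<union> ((\<lambda>x. m (x / (x + 1))) ` {0<..} - \<rat>)"
proof (intro set_eqI iffI)
  fix y assume y: "y \<in> m ` {0<..} - \<rat>"
  then obtain x where x: "x > 0" "y = m x" by auto
  have "m 1 \<in> \<rat>" using assms unfolding sb_branch_def by auto
  hence "x \<noteq> 1" using x y by auto
  then consider "x > 1" | "x < 1" by linarith
  thus "y \<in> ((\<lambda>x. m (x + 1)) ` {0<..} - \<rat>) \<union> ((\<lambda>x. m (x / (x + 1))) ` {0<..} - \<rat>)"
  proof cases
    case 1
    hence "y = m ((x - 1) + 1)" "x - 1 > 0" using x by auto
    thus ?thesis using y by blast
  next
    case 2
    let ?u = "x / (1 - x)"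
    have "?u > 0" "?u / (?u + 1) = x" using 2 x by (auto simp: field_simps)
    thus ?thesis using x y by (metis (mono_tags, lifting) DiffD2 DiffI UnI2 greaterThan_iff image_eqI)
  qed
qed auto

text \<open>
  The two summands are the masses of the right and the left child, and each is at most \<open>q\<close> times
  the mass of the parent. The right one is \<open>q / (1 + \<rho>)\<close> times it. The left one is
  \<open>q (1 - q + \<rho>) / (1 + q \<rho>)\<close> times it, and \<open>1 - q + \<rho> \<le> 1 + q \<rho>\<close> is exactly the bound
  \<open>\<rho> \<le> q / (1 - q)\<close>.
\<close>

lemma sb_branch_children_mass:
  assumes "0 \<le> \<kappa>" "0 \<le> \<rho>" "\<rho> \<le> q / (1 - q)"
  shows "\<kappa> * q / (1 + \<rho>)\<^sup>2 / (1 - q + q * \<rho> / (1 + \<rho>)) + \<kappa> * q / (1 - q + q * (1 + \<rho>))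
    \<le> 2 * q * (\<kappa> / (1 - q + \<rho>))"
proof -
  have pos: "1 - q + \<rho> > 0" "1 + \<rho> > 0" "1 + q * \<rho> > 0" using assms q by (auto simp: add_pos_nonneg)
  have "\<rho> * (1 - q) \<le> q" using assms q by (simp add: field_simps)
  hence le: "1 - q + \<rho> \<le> 1 + q * \<rho>" by (simp add: algebra_simps)
  have "(1 + \<rho>)\<^sup>2 * (1 - q + q * \<rho> / (1 + \<rho>)) = (1 + \<rho>) * (1 - q + \<rho>)"
    using pos by (simp add: field_simps power2_eq_square)
  hence "\<kappa> * q / (1 + \<rho>)\<^sup>2 / (1 - q + q * \<rho> / (1 + \<rho>)) = \<kappa> * q / ((1 + \<rho>) * (1 - q + \<rho>))"
    by simp
  also have "\<dots> \<le> \<kappa> * q / (1 * (1 - q + \<rho>))"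
    using pos assms q by (intro divide_left_mono mult_right_mono mult_pos_pos) auto
  finally have R: "\<kappa> * q / (1 + \<rho>)\<^sup>2 / (1 - q + q * \<rho> / (1 + \<rho>)) \<le> q * (\<kappa> / (1 - q + \<rho>))"
    by (simp add: mult.commute)
  have "\<kappa> * q / (1 + q * \<rho>) \<le> \<kappa> * q / (1 - q + \<rho>)"
    using pos le assms q by (intro divide_left_mono) auto
  hence "\<kappa> * q / (1 - q + q * (1 + \<rho>)) \<le> q * (\<kappa> / (1 - q + \<rho>))"
    by (simp add: algebra_simps)
  from add_mono[OF R this] show ?thesis by (simp only: mult.assoc mult_2 distrib_right)
qed

text \<open>
  The induction ranges over all branches at once, because the step passes from an interval to
  its two children; the point \<open>m 1\<close> between them is rational and drops out.
\<close>

lemma sb_branch_irrational_mass: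
  assumes "sb_branch m \<kappa> \<rho>"
  shows "emeasure (mu q) (m ` {0<..} - \<rat>) \<le> ennreal ((2 * q) ^ n * (\<kappa> / (1 - q + \<rho>)))"
  using assms
proof (induction n arbitrary: m \<kappa> \<rho>)
  case 0
  have "m ` {0<..} \<in> sets (mu q)" using sb_branch_measure(1)[OF 0] by (simp add: sets_mu)
  hence "emeasure (mu q) (m ` {0<..} - \<rat>) \<le> emeasure (mu q) (m ` {0<..})"
    by (intro emeasure_mono) auto
  then show ?case using sb_branch_measure(2)[OF 0] by simp
next
  case (Suc n)
  note b = Suc.prems[unfolded sb_branch_def]
  note L = sb_branch_left[OF Suc.prems] and R = sb_branch_right[OF Suc.prems]
  let ?L = "(\<lambda>x. m (x / (x + 1))) ` {0<..} - \<rat>" and ?R = "(\<lambda>x. m (x + 1)) ` {0<..} - \<rat>"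
  let ?l = "\<kappa> * q / (1 - q + q * (1 + \<rho>))"
    and ?r = "\<kappa> * q / (1 + \<rho>)\<^sup>2 / (1 - q + q * \<rho> / (1 + \<rho>))"
  have nn: "?l \<ge> 0" "?r \<ge> 0" using b q by auto
  have p: "(2 * q) ^ n \<ge> 0" using q by simp
  have "emeasure (mu q) (m ` {0<..} - \<rat>) \<le> emeasure (mu q) ?R + emeasure (mu q) ?L"
    unfolding sb_branch_split[OF Suc.prems]
    using sb_branch_measure(1)[OF L] sb_branch_measure(1)[OF R] rat_borel
    by (intro emeasure_subadditive) (auto simp: sets_mu)
  also have "\<dots> \<le> ennreal ((2 * q) ^ n * ?r) + ennreal ((2 * q) ^ n * ?l)"
    by (intro add_mono Suc.IH L R)
  also have "\<dots> = ennreal ((2 * q) ^ n * (?r + ?l))"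
    unfolding distrib_left[of "(2 * q) ^ n" ?r ?l]
    by (rule ennreal_plus[OF mult_nonneg_nonneg[OF p nn(2)] mult_nonneg_nonneg[OF p nn(1)], symmetric])
  also have "\<dots> \<le> ennreal ((2 * q) ^ n * (2 * q * (\<kappa> / (1 - q + \<rho>))))"
    using b q by (intro ennreal_leI mult_left_mono sb_branch_children_mass) auto
  also have "\<dots> = ennreal ((2 * q) ^ Suc n * (\<kappa> / (1 - q + \<rho>)))" by (simp add: mult_ac)
  finally show ?case .
qed

section \<open>Pure atomicity\<close>

lemma emeasure_mu_irrational:
  assumes "q < 1 / 2"
  shows "emeasure (mu q) (- \<rat>) = 0"
proof -
  let ?I = "\<lambda>n. (\<lambda>x. x - real n) ` {0<..} - \<rat>"
  have "emeasure (mu q) (?I n) = 0" for n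
  proof -
    have "(\<lambda>k. ennreal ((2 * q) ^ k * (1 / q ^ n / (1 - q + 0)))) \<longlonglongrightarrow> ennreal (0 * (1 / q ^ n / (1 - q + 0)))"
      using assms q by (intro tendsto_ennrealI tendsto_intros LIMSEQ_power_zero) auto
    hence "emeasure (mu q) (?I n) \<le> ennreal (0 * (1 / q ^ n / (1 - q + 0)))"
      using sb_branch_irrational_mass[OF sb_branch_shift[of n]] by (intro LIMSEQ_le_const) auto
    thus ?thesis by simp
  qed
  moreover have "?I n \<in> sets (mu q)" for n
    using sb_branch_measure(1)[OF sb_branch_shift[of n]] rat_borel by (simp add: sets_mu sets.Diff)
  ultimately have "(\<Union>n. ?I n) \<in> null_sets (mu q)"
    by (intro null_sets_UN) (auto simp: null_sets_def)
  moreover have "(\<Union>n. ?I n) = - \<rat>"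
  proof (intro set_eqI iffI)
    fix x :: real assume x: "x \<in> - \<rat>"
    obtain n where "- x < real n" using reals_Archimedean2 by blast
    hence "x = (x + real n) - real n" "x + real n \<in> {0<..}" by auto
    thus "x \<in> (\<Union>n. ?I n)" using x by blast
  qed auto
  ultimately show ?thesis by (auto simp: null_sets_def)
qed

text \<open>
  The countably many rational points carry all the mass.
\<close>

lemma emeasure_mu_eq_jumps:
  assumes "q < 1 / 2" and A: "A \<in> sets borel"
  shows "emeasure (mu q) A = (\<integral>\<^sup>+ y. ennreal (jump q y) \<partial>count_space (\<rat> \<inter> A))"
proof -
  have "A \<inter> - \<rat> \<in> null_sets (mu q)"
    using emeasure_mu_irrational[OF assms(1)] A rat_borel
    by (intro null_set_Int1) (auto simp: null_sets_def sets_mu)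
  hence "emeasure (mu q) A = emeasure (mu q) (A - A \<inter> - \<rat>)"
    using A by (intro emeasure_Diff_null_set[symmetric]) (auto simp: sets_mu)
  also have "A - A \<inter> - \<rat> = \<rat> \<inter> A" by auto
  also have "emeasure (mu q) (\<rat> \<inter> A) = (\<integral>\<^sup>+ y. emeasure (mu q) {y} \<partial>count_space (\<rat> \<inter> A))"
    by (intro emeasure_countable_singleton countable_Int1 countable_rat) (auto simp: sets_mu)
  finally show ?thesis by (simp add: emeasure_mu_singleton)
qed

lemma jump_has_sum:
  assumes "q < 1 / 2" "A \<in> sets borel" "emeasure (mu q) A = ennreal s" "s \<ge> 0"
  shows "(jump q has_sum s) (\<rat> \<inter> A)"
proof -
  have n: "(\<integral>\<^sup>+ y. ennreal (jump q y) \<partial>count_space (\<rat> \<inter> A)) = ennreal s"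
    using emeasure_mu_eq_jumps[OF assms(1,2)] assms(3) by simp
  hence "has_bochner_integral (count_space (\<rat> \<inter> A)) (jump q) s"
    using assms(4) jump_nonneg by (intro has_bochner_integral_nn_integral) auto
  hence i: "integrable (count_space (\<rat> \<inter> A)) (jump q)" "infsetsum (jump q) (\<rat> \<inter> A) = s"
    by (auto simp: has_bochner_integral_iff infsetsum_def)
  hence abs: "Infinite_Set_Sum.abs_summable_on (jump q) (\<rat> \<inter> A)" by (simp add: abs_summable_on_def)
  hence "jump q summable_on (\<rat> \<inter> A)"
    using abs_summable_equivalent abs_summable_summable by blast
  thus ?thesis using infsetsum_infsum[OF abs] i by (simp add: has_sum_infsum)
qed

lemma emeasure_mu_Ioi: "emeasure (mu q) {x<..} = ennreal (1 / (1 - q) - qreal q x)"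
  and qreal_le: "qreal q x \<le> 1 / (1 - q)"
proof -
  obtain k where k: "x \<le> real k" using real_arch_simple by blast
  have lim: "(\<lambda>n. qreal q (real (n + k))) \<longlonglongrightarrow> 1 / (1 - q)"
    unfolding qreal_of_nat using qint_tendsto by (rule LIMSEQ_ignore_initial_segment)
  show "qreal q x \<le> 1 / (1 - q)"
    using k by (intro LIMSEQ_le_const[OF lim]) (auto intro!: qreal_mono)
  have "(\<Union>n. {x<..real (n + k)}) = {x<..}"
  proof (intro set_eqI iffI)
    fix y assume y: "y \<in> {x<..}"
    obtain n where "y \<le> real n" using real_arch_simple by blast
    thus "y \<in> (\<Union>n. {x<..real (n + k)})" using y by (auto intro!: exI[of _ n])
  qed auto
  moreover have "(\<lambda>n. emeasure (mu q) {x<..real (n + k)}) \<longlonglongrightarrow> emeasure (mu q) (\<Union>n. {x<..real (n + k)})"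
    by (rule Lim_emeasure_incseq) (auto simp: sets_mu incseq_def)
  moreover have "(\<lambda>n. emeasure (mu q) {x<..real (n + k)}) \<longlonglongrightarrow> ennreal (1 / (1 - q) - qreal q x)"
  proof -
    have "(\<lambda>n. qreal q (real (n + k)) - qreal q x) \<longlonglongrightarrow> 1 / (1 - q) - qreal q x"
      by (intro tendsto_intros lim)
    thus ?thesis using k by (subst emeasure_mu_Ioc) (auto intro!: tendsto_ennrealI)
  qed
  ultimately show "emeasure (mu q) {x<..} = ennreal (1 / (1 - q) - qreal q x)"
    using LIMSEQ_unique by metis
qed

text \<open>
  The null measure is an atomless part because the jumps already give the whole measure. It is
  the only one: on the rationals an atomless measure vanishes by countability, and on the
  irrationals it is dominated by \<open>mu q\<close>, which vanishes there.
\<close>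

lemma mu_star_eq_null_measure:
  assumes "q < 1 / 2"
  shows "mu_star q = null_measure borel"
  unfolding mu_star_def
proof (rule the_equality)
  have J: "(\<integral>\<^sup>+ y. ennreal (jump q y) * indicator A y \<partial>count_space \<rat>) = emeasure (mu q) A"
    if "A \<in> sets borel" for A
    unfolding emeasure_mu_eq_jumps[OF assms that]
    by (subst (1 2) nn_integral_count_space_indicator)
       (auto intro!: nn_integral_cong split: split_indicator)
  show "is_atomless_part q (null_measure borel)"
    by (simp add: is_atomless_part_def J)
  fix \<nu> assume \<nu>: "is_atomless_part q \<nu>"
  have sets: "sets \<nu> = sets borel" using \<nu> by (simp add: is_atomless_part_def)
  have "emeasure \<nu> \<rat> = (\<integral>\<^sup>+ y. emeasure \<nu> {y} \<partial>count_space \<rat>)"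
    using sets by (intro emeasure_countable_singleton countable_rat) auto
  hence rat: "emeasure \<nu> \<rat> = 0" using \<nu> by (simp add: is_atomless_part_def)
  have "emeasure (mu q) (- \<rat>) = emeasure \<nu> (- \<rat>) + emeasure (mu q) (- \<rat>)"
    using \<nu> J[of "- \<rat>"] rat_borel unfolding is_atomless_part_def by (metis borel_comp)
  hence irr: "emeasure \<nu> (- \<rat>) = 0" by (simp add: emeasure_mu_irrational[OF assms])
  have "emeasure \<nu> A \<le> emeasure \<nu> \<rat> + emeasure \<nu> (- \<rat>)" if "A \<in> sets \<nu>" for A
  proof -
    have "emeasure \<nu> A \<le> emeasure \<nu> (\<rat> \<union> - \<rat>)"
      using rat_borel sets by (intro emeasure_mono) auto
    also have "\<dots> \<le> emeasure \<nu> \<rat> + emeasure \<nu> (- \<rat>)"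
      using rat_borel sets by (intro emeasure_subadditive) auto
    finally show ?thesis .
  qed
  thus "\<nu> = null_measure borel" using rat irr sets by (intro measure_eqI) auto
qed

end

theorem corollary6p4:
  fixes q :: real
  assumes "0 < q" and "q < 1 / 2"
  shows "mu_star q = null_measure borel \<and>
         (\<forall>x>0. (jump q has_sum qreal q x) (\<rat> \<inter> {0<..x})) \<and>
         (\<forall>x. qreal_star q x = 1 / (1 - q))"
proof (intro conjI allI impI)
  have q: "0 < q" "q < 1" using assms by auto
  show "mu_star q = null_measure borel" using q assms by (intro mu_star_eq_null_measure)
  show "(jump q has_sum qreal q x) (\<rat> \<inter> {0<..x})" if "x > 0" for x
  proof (rule jump_has_sum[OF q assms(2)])
    show "emeasure (mu q) {0<..x} = ennreal (qreal q x)"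
      using emeasure_mu_Ioc[OF q, of 0 x] that qreal_0[OF q] by simp
    show "qreal q x \<ge> 0" using that by (intro qreal_nonneg[OF q]) simp
  qed simp
  show "qreal_star q x = 1 / (1 - q)" for x
  proof -
    have "(jump q has_sum (1 / (1 - q) - qreal q x)) (\<rat> \<inter> {x<..})"
      using emeasure_mu_Ioi[OF q, of x] qreal_le[OF q, of x]
      by (intro jump_has_sum[OF q assms(2)]) auto
    moreover have "{y \<in> \<rat>. y > x} = \<rat> \<inter> {x<..}" by auto
    ultimately show ?thesis unfolding qreal_star_def by (simp add: infsumI)
  qed
qed

end
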